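(* Let $r,s\in\mathbb C$ and $q\in\mathbb Z_4$. On $I'(q,r,s)$ the Casimir element $\Omega$ acts by $$\Omega=\frac12\left(4sx^2\partial_t+x^2\partial_x^2-(1+2r)x\partial_x+r(r+2)\right).$$ In particular, for $r=-1/2$ and $s=i/2$ and any $\lambda\in\mathbb R$, $\Omega'=2\Omega-r(r+2)$ satisfies $$\Omega'-2\lambda=x^2\left(\Box-2\lambda/x^2\right),\qquad \Box=2i\partial_t+\partial_x^2,$$ so that, in $I'(q,-1/2,i/2)$, $$\ker(\Omega'-2\lambda)=\ker(\Box-2\lambda/x^2).$$
   Context: Group. $H_3$ is $\mathbb R^3$ with product $(v_1,v_2,v_3)(v_1',v_2',v_3')=(v_1+v_1',v_2+v_2',v_3+v_3'+v_1v_2'-v_2v_1')$. $\widetilde{G_0}$ is the two-fold cover of $SL(2,\mathbb R)$, realized as pairs $(g,\epsilon)$ with $g=\left(\begin{smallmatrix}a&b\\c&d\end{smallmatrix}\right)\in SL(2,\mathbb R)$ and $\epsilon$ a smooth function on the upper half plane with $\epsilon(z)^2=cz+d$, with product $(g_1,\epsilon_1(z))(g_2,\epsilon_2(z))=(g_1g_2,\epsilon_1(g_2.z)\epsilon_2(z))$, where $g.z=\frac{az+b}{cz+d}$. $G=\widetilde{G_0}\ltimes H_3$, where $\widetilde{G_0}$ acts on $H_3$ through $SL(2,\mathbb R)$ by the standard action on the first two coordinates and trivially on the third; $[g,h]$ denotes the element $gh$, $g\in\widetilde{G_0}$, $h\in H_3$. Induced representation. $\overline P\subset G$ is the subgroup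 of elements $\left[\left((-1)^j\left(\begin{smallmatrix}a&0\\c&a^{-1}\end{smallmatrix}\right),z\mapsto i^{-j}a^{-1/2}\sqrt{acz+1}\right),(0,v,w)\right]$ with $a>0$, $c,v,w\in\mathbb R$, $j\in\{0,1,2,3\}$, and $\chi_{q,r,s}$ is the character of $\overline P$ with value $i^{jq}a^re^{sw}$ on this element. $I(q,r,s)$ is the space of $\phi\in C^\infty(G)$ with $\phi(g\overline p)=\chi_{q,r,s}(\overline p)^{-1}\phi(g)$ for $g\in G$, $\overline p\in\overline P$, with $G$ acting by left translation $(g_1.\phi)(g_2)=\phi(g_1^{-1}g_2)$. With $N_{t,x}=\left[\left(\left(\begin{smallmatrix}1&t\\0&1\end{smallmatrix}\right),z\mapsto1\right),(x,0,0)\right]$, the non-compact picture is $$I'(q,r,s)=\{f\in C^\infty(\mathbb R^2): f(t,x)=\phi(N_{t,x})\text{ for some }\phi\in I(q,r,s)\},$$ with the transported action. The standard $\mathfrak{sl}_2$-triple $\{h,e^+,e^-\}$ acts on $I'(q,r,s)$ by $$h=-x\partial_x-2t\partial_t+r,\qquad e^+=-\partial_t,\qquad e^-=tx\partial_x+t^2\partial_t-(sx^2+rt).$$ The Casimir element is $\Omega=\tfrac12h^2-h+2e^+e^-$. For $f\in I'(q,r,s)$, $f\in\ker(\Box-2\lambda/x^2)$ means $\Box f=2\lambda x^{-2}f$ for $x\neq0$. *)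

theory Defs
  imports "HOL-Analysis.Analysis" "HOL-Algebra.Group"
begin

section \<open>Smooth functions\<close>

text \<open>For open \<open>S\<close> in a Euclidean space, this is the usual class \<open>C\<^sup>k(S)\<close>:
  a function is in the class \<open>k + 1\<close> iff it is (Frechet) differentiable and all its directional
  derivatives are in the class \<open>k\<close>.\<close>

primrec Ck_on :: "nat \<Rightarrow> 'a::euclidean_space set \<Rightarrow> ('a \<Rightarrow> 'b::real_normed_vector) \<Rightarrow> bool" where
  "Ck_on 0 S f \<longleftrightarrow> continuous_on S f"
| "Ck_on (Suc k) S f \<longleftrightarrow> (\<forall>x\<in>S. f differentiable (at x)) \<and>
     (\<forall>v. Ck_on k S (\<lambda>x. frechet_derivative f (at x) v))"

definition smooth_on :: "'a::euclidean_space set \<Rightarrow> ('a \<Rightarrow> 'b::real_normed_vector) \<Rightarrow> bool" where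
  "smooth_on S f \<longleftrightarrow> (\<forall>k. Ck_on k S f)"

section \<open>The group\<close>

type_synonym heis_elem = "real \<times> real \<times> real"
type_synonym mp_elem = "(real^2^2) \<times> (complex \<Rightarrow> complex)"
type_synonym jac_elem = "mp_elem \<times> heis_elem"

definition heis_group :: "heis_elem monoid" where
  "heis_group = \<lparr> carrier = UNIV,
     monoid.mult = (\<lambda>(v1, v2, v3) (w1, w2, w3). (v1 + w1, v2 + w2, v3 + w3 + v1 * w2 - v2 * w1)),
     one = (0, 0, 0) \<rparr>"

definition upper_half_plane :: "complex set" where
  "upper_half_plane = {z. Im z > 0}"

definition mat22 :: "real \<Rightarrow> real \<Rightarrow> real \<Rightarrow> real \<Rightarrow> real^2^2" where
  "mat22 a b c d = vector [vector [a, b], vector [c, d]]"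

definition moebius :: "real^2^2 \<Rightarrow> complex \<Rightarrow> complex" where
  "moebius g z = (of_real (g$1$1) * z + of_real (g$1$2)) / (of_real (g$2$1) * z + of_real (g$2$2))"

text \<open>The two-fold cover of \<open>SL(2,\<real>)\<close>. Functions on the upper half plane are represented by
  extensional functions, so that equality of group elements is equality in HOL.\<close>

definition mp_group :: "mp_elem monoid" where
  "mp_group = \<lparr> carrier = {(g, \<epsilon>). det g = 1 \<and> \<epsilon> \<in> extensional upper_half_plane \<and>
       smooth_on upper_half_plane \<epsilon> \<and>
       (\<forall>z\<in>upper_half_plane. (\<epsilon> z)\<^sup>2 = of_real (g$2$1) * z + of_real (g$2$2))},
     monoid.mult = (\<lambda>(g1, \<epsilon>1) (g2, \<epsilon>2).
       (g1 ** g2, \<lambda>z\<in>upper_half_plane. \<epsilon>1 (moebius g2 z) * \<epsilon>2 z)),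
     one = (mat 1, \<lambda>z\<in>upper_half_plane. 1) \<rparr>"

definition heis_act :: "real^2^2 \<Rightarrow> heis_elem \<Rightarrow> heis_elem" where
  "heis_act g = (\<lambda>(v1, v2, v3). (g$1$1 * v1 + g$1$2 * v2, g$2$1 * v1 + g$2$2 * v2, v3))"

text \<open>The pair \<open>(g, h)\<close> stands for the product \<open>gh\<close>, whence
  \<open>(gh)(g'h') = (gg') ((g'\<inverse>.h) h')\<close>.\<close>

definition jac_group :: "jac_elem monoid" where
  "jac_group = \<lparr> carrier = carrier mp_group \<times> carrier heis_group,
     monoid.mult = (\<lambda>(g, h) (g', h').
       (g \<otimes>\<^bsub>mp_group\<^esub> g', heis_act (matrix_inv (fst g')) h \<otimes>\<^bsub>heis_group\<^esub> h')),
     one = (\<one>\<^bsub>mp_group\<^esub>, \<one>\<^bsub>heis_group\<^esub>) \<rparr>"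

text \<open>The one-parameter subgroups of the double cover generated by the standard
  \<open>sl\<^sub>2\<close>-triple \<open>h = diag(1,-1)\<close>, \<open>e\<^sup>+ = E\<^sub>1\<^sub>2\<close>, \<open>e\<^sup>- = E\<^sub>2\<^sub>1\<close>. For \<open>z\<close> in the upper half plane
  \<open>u z + 1\<close> avoids the cut of the principal square root, so \<open>exp_em\<close> is the continuous lift
  through the identity.\<close>

definition exp_h :: "real \<Rightarrow> mp_elem" where
  "exp_h u = (mat22 (exp u) 0 0 (exp (- u)), \<lambda>z\<in>upper_half_plane. of_real (exp (- u / 2)))"

definition exp_ep :: "real \<Rightarrow> mp_elem" where
  "exp_ep u = (mat22 1 u 0 1, \<lambda>z\<in>upper_half_plane. 1)"

definition exp_em :: "real \<Rightarrow> mp_elem" where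
  "exp_em u = (mat22 1 0 u 1, \<lambda>z\<in>upper_half_plane. csqrt (of_real u * z + 1))"

text \<open>The map \<open>big_cell\<close> is a diffeomorphism of \<open>\<real>\<^sup>6\<close> onto an open neighbourhood of the identity
  in the Lie group; its left translates form an atlas. A function on the group is smooth
  iff it is smooth in all charts of this atlas.\<close>

definition big_cell :: "real \<times> real \<times> real \<times> real \<times> real \<times> real \<Rightarrow> jac_elem" where
  "big_cell = (\<lambda>(t, u, c, v1, v2, v3).
     ((exp_ep t \<otimes>\<^bsub>mp_group\<^esub> exp_h u) \<otimes>\<^bsub>mp_group\<^esub> exp_em c, (v1, v2, v3)))"

definition smooth_jac :: "(jac_elem \<Rightarrow> complex) \<Rightarrow> bool" where
  "smooth_jac \<phi> \<longleftrightarrow>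
     (\<forall>g\<in>carrier jac_group. smooth_on UNIV (\<lambda>y. \<phi> (g \<otimes>\<^bsub>jac_group\<^esub> big_cell y)))"

section \<open>The induced representation\<close>

definition pbar :: "nat \<Rightarrow> real \<Rightarrow> real \<Rightarrow> real \<Rightarrow> real \<Rightarrow> jac_elem" where
  "pbar j a c v w =
     (((- 1) ^ j *\<^sub>R mat22 a 0 c (inverse a),
       \<lambda>z\<in>upper_half_plane.
         inverse (\<i> ^ j) * of_real (a powr (- 1 / 2)) * csqrt (of_real (a * c) * z + 1)),
      (0, v, w))"

text \<open>The value of the character at \<open>pbar j a c v w\<close>.\<close>

definition chi :: "nat \<Rightarrow> complex \<Rightarrow> complex \<Rightarrow> nat \<Rightarrow> real \<Rightarrow> real \<Rightarrow> complex" where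
  "chi q r s j a w = \<i> ^ (j * q) * of_real a powr r * exp (s * of_real w)"

definition ind_rep :: "nat \<Rightarrow> complex \<Rightarrow> complex \<Rightarrow> (jac_elem \<Rightarrow> complex) set" where
  "ind_rep q r s = {\<phi>. smooth_jac \<phi> \<and>
     (\<forall>g\<in>carrier jac_group. \<forall>j\<in>{0..3}. \<forall>a>0. \<forall>c v w.
        \<phi> (g \<otimes>\<^bsub>jac_group\<^esub> pbar j a c v w) = inverse (chi q r s j a w) * \<phi> g)}"

definition left_transl :: "jac_elem \<Rightarrow> (jac_elem \<Rightarrow> complex) \<Rightarrow> jac_elem \<Rightarrow> complex" where
  "left_transl g1 \<phi> g2 = \<phi> (inv\<^bsub>jac_group\<^esub> g1 \<otimes>\<^bsub>jac_group\<^esub> g2)"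

text \<open>The derived action of the generator of a one-parameter subgroup \<open>\<gamma>\<close>.\<close>

definition derived_act ::
  "(real \<Rightarrow> mp_elem) \<Rightarrow> (jac_elem \<Rightarrow> complex) \<Rightarrow> jac_elem \<Rightarrow> complex" where
  "derived_act \<gamma> \<phi> g =
     vector_derivative (\<lambda>u. left_transl (\<gamma> u, \<one>\<^bsub>heis_group\<^esub>) \<phi> g) (at 0)"

definition casimir :: "(jac_elem \<Rightarrow> complex) \<Rightarrow> jac_elem \<Rightarrow> complex" where
  "casimir \<phi> g =
     1 / 2 * derived_act exp_h (derived_act exp_h \<phi>) g - derived_act exp_h \<phi> g
       + 2 * derived_act exp_ep (derived_act exp_em \<phi>) g"

section \<open>The non-compact picture\<close>

definition N_elem :: "real \<Rightarrow> real \<Rightarrow> jac_elem" where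
  "N_elem t x = ((mat22 1 t 0 1, \<lambda>z\<in>upper_half_plane. 1), (x, 0, 0))"

definition restr_N :: "(jac_elem \<Rightarrow> complex) \<Rightarrow> real \<times> real \<Rightarrow> complex" where
  "restr_N \<phi> = (\<lambda>(t, x). \<phi> (N_elem t x))"

definition noncompact :: "nat \<Rightarrow> complex \<Rightarrow> complex \<Rightarrow> (real \<times> real \<Rightarrow> complex) set" where
  "noncompact q r s = {f. smooth_on UNIV f \<and> (\<exists>\<phi>\<in>ind_rep q r s. f = restr_N \<phi>)}"

text \<open>Transport of an operator along \<open>restr_N\<close>. Functions on the group are represented by
  HOL functions whose values outside the carrier are irrelevant, so a preimage under \<open>restr_N\<close> is
  unique only on the carrier.\<close>

definition transport :: "nat \<Rightarrow> complex \<Rightarrow> complex \<Rightarrow>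
    ((jac_elem \<Rightarrow> complex) \<Rightarrow> jac_elem \<Rightarrow> complex) \<Rightarrow>
    (real \<times> real \<Rightarrow> complex) \<Rightarrow> real \<times> real \<Rightarrow> complex" where
  "transport q r s A f = restr_N (A (inv_into (ind_rep q r s) restr_N f))"

definition Omega :: "nat \<Rightarrow> complex \<Rightarrow> complex \<Rightarrow>
    (real \<times> real \<Rightarrow> complex) \<Rightarrow> real \<times> real \<Rightarrow> complex" where
  "Omega q r s = transport q r s casimir"

definition Omega' :: "nat \<Rightarrow> complex \<Rightarrow> complex \<Rightarrow>
    (real \<times> real \<Rightarrow> complex) \<Rightarrow> real \<times> real \<Rightarrow> complex" where
  "Omega' q r s f p = 2 * Omega q r s f p - r * (r + 2) * f p"

definition d_t :: "(real \<times> real \<Rightarrow> complex) \<Rightarrow> real \<times> real \<Rightarrow> complex" where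
  "d_t f = (\<lambda>(t, x). vector_derivative (\<lambda>\<tau>. f (\<tau>, x)) (at t))"

definition d_x :: "(real \<times> real \<Rightarrow> complex) \<Rightarrow> real \<times> real \<Rightarrow> complex" where
  "d_x f = (\<lambda>(t, x). vector_derivative (\<lambda>\<xi>. f (t, \<xi>)) (at x))"

definition Box :: "(real \<times> real \<Rightarrow> complex) \<Rightarrow> real \<times> real \<Rightarrow> complex" where
  "Box f p = 2 * \<i> * d_t f p + d_x (d_x f) p"

end

theory Submission
  imports Defs "HOL-Complex_Analysis.Cauchy_Integral_Formula"
begin

text \<open>On \<open>\<phi> \<in> I(q, r, s)\<close> the one-parameter subgroups act by \<open>\<phi>(\<gamma>(-u) N_elem t x)\<close>. Writing
  \<open>\<gamma>(-u) N_elem t x\<close> as \<open>N_elem t' x'\<close> times an element of the parabolic subgroup turns this into a multiplier times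
  \<open>f (t', x')\<close>, whose \<open>u\<close>-derivative at \<open>0\<close> is the usual first-order operator. Composing these
  operators gives the formula for the Casimir element, the mixed second derivatives cancelling.\<close>

section \<open>Smooth functions and partial derivatives\<close>

text \<open>The derivative in direction \<open>v\<close> is \<open>deriv f x * v\<close>, again
  holomorphic in \<open>x\<close>, so the induction goes through. It serves to check the smoothness
  condition on the second components of elements of \<open>mp_group\<close>.\<close>

lemma holomorphic_imp_Ck_on:
  assumes "open S" "f holomorphic_on S"
  shows "Ck_on k S f"
  using assms(2)
proof (induction k arbitrary: f)
  case 0
  then show ?case by (simp add: holomorphic_on_imp_continuous_on)
next
  case (Suc k)
  have D: "(f has_derivative (*) (deriv f x)) (at x)" if "x \<in> S" for x
    using Suc.prems assms(1) that
    by (meson holomorphic_derivI has_field_derivative_def)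
  have "(\<lambda>x. frechet_derivative f (at x) v) holomorphic_on S" for v
  proof (rule holomorphic_transform)
    show "(\<lambda>x. deriv f x * v) holomorphic_on S"
      using Suc.prems assms(1) by (intro holomorphic_intros) auto
    show "\<And>x. x \<in> S \<Longrightarrow> deriv f x * v = frechet_derivative f (at x) v"
      using D by (metis frechet_derivative_at)
  qed
  then show ?case using Suc.IH D by (auto simp: differentiable_def)
qed

lemma holomorphic_imp_smooth_on:
  "open S \<Longrightarrow> f holomorphic_on S \<Longrightarrow> smooth_on S f"
  by (simp add: smooth_on_def holomorphic_imp_Ck_on)

lemma smooth_on_UNIV_D:
  assumes "smooth_on UNIV f"
  shows "f differentiable at p" "continuous_on UNIV f"
    "smooth_on UNIV (\<lambda>p. frechet_derivative f (at p) v)"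
proof -
  have C: "Ck_on k UNIV f" for k
    using assms by (simp add: smooth_on_def)
  show "f differentiable at p" using C[of 1] by simp
  show "continuous_on UNIV f" using C[of 0] by simp
  show "smooth_on UNIV (\<lambda>p. frechet_derivative f (at p) v)"
    unfolding smooth_on_def using C[of "Suc _"] by simp
qed

text \<open>The chain rule along the two coordinate lines through \<open>p\<close> identifies the
  partials with \<open>D (1, 0)\<close> and \<open>D (0, 1)\<close>; linearity of \<open>D\<close>
  recovers every other direction.\<close>

lemma smooth_on_has_derivative_partials:
  assumes "smooth_on UNIV f"
  shows "(f has_derivative (\<lambda>(a, b). a *\<^sub>R d_t f p + b *\<^sub>R d_x f p)) (at p)"
    and "d_t f p = frechet_derivative f (at p) (1, 0)"
    and "d_x f p = frechet_derivative f (at p) (0, 1)"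
proof -
  obtain t x where p: "p = (t, x)" by (cases p)
  define D where "D = frechet_derivative f (at p)"
  have D: "(f has_derivative D) (at p)"
    using smooth_on_UNIV_D(1)[OF assms] frechet_derivative_works D_def by blast
  then have D_p: "(f has_derivative D) (at (t, x))"
    by (simp add: p)
  interpret bounded_linear D using D by (rule has_derivative_bounded_linear)
  have "((\<lambda>\<tau>. (\<tau>, x)) has_derivative (\<lambda>a. (a, 0))) (at t)"
    "((\<lambda>\<xi>. (t, \<xi>)) has_derivative (\<lambda>a. (0, a))) (at x)"
    by (auto intro!: derivative_eq_intros)
  from this[THEN has_derivative_compose, OF D_p]
  have "((\<lambda>\<tau>. f (\<tau>, x)) has_vector_derivative D (1, 0)) (at t)"
    "((\<lambda>\<xi>. f (t, \<xi>)) has_vector_derivative D (0, 1)) (at x)"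
    by (simp_all add: has_vector_derivative_def flip: scaleR)
  then have t: "d_t f p = D (1, 0)" and x: "d_x f p = D (0, 1)"
    by (simp_all add: d_t_def d_x_def p vector_derivative_at)
  then show "d_t f p = frechet_derivative f (at p) (1, 0)"
    "d_x f p = frechet_derivative f (at p) (0, 1)"
    by (simp_all add: D_def)
  have "D v = (case v of (a, b) \<Rightarrow> a *\<^sub>R d_t f p + b *\<^sub>R d_x f p)" for v
    by (cases v) (simp add: t x flip: scaleR add)
  then show "(f has_derivative (\<lambda>(a, b). a *\<^sub>R d_t f p + b *\<^sub>R d_x f p)) (at p)"
    by (intro has_derivative_eq_rhs[OF D]) blast
qed

lemma smooth_on_partials:
  assumes "smooth_on UNIV f"
  shows "smooth_on UNIV (d_t f)" "smooth_on UNIV (d_x f)"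
proof -
  have "d_t f = (\<lambda>p. frechet_derivative f (at p) (1, 0))" "d_x f = (\<lambda>p. frechet_derivative f (at p) (0, 1))"
    using smooth_on_has_derivative_partials(2,3)[OF assms] by blast+
  then show "smooth_on UNIV (d_t f)" "smooth_on UNIV (d_x f)"
    using smooth_on_UNIV_D(3)[OF assms] by simp_all
qed

lemma has_vector_derivative_comp_partials:
  assumes f: "smooth_on UNIV f"
    and T: "(T has_real_derivative T') (at u)" and X: "(X has_real_derivative X') (at u)"
  shows "((\<lambda>u. f (T u, X u)) has_vector_derivative
    of_real T' * d_t f (T u, X u) + of_real X' * d_x f (T u, X u)) (at u)"
proof -
  have "((\<lambda>u. (T u, X u)) has_derivative (\<lambda>h. (T' * h, X' * h))) (at u)"
    using T X by (auto intro!: has_derivative_Pair simp: has_field_derivative_def)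
  from has_derivative_compose[OF this smooth_on_has_derivative_partials(1)[OF f]]
  show ?thesis
    by (simp add: has_vector_derivative_def scaleR_conv_of_real algebra_simps)
qed

text \<open>Both sides are read off \<open>f (t, y) - f (t, a) = \<integral>\<^sub>a\<^sup>y d_x f (t, \<eta>) d\<eta>\<close> by differentiating
  under the integral sign.\<close>

lemma smooth_on_imp_partials_commute:
  assumes f: "smooth_on UNIV f"
  shows "d_t (d_x f) (t, x) = d_x (d_t f) (t, x)"
proof -
  note fx = smooth_on_partials(2)[OF f] and ft = smooth_on_partials(1)[OF f]
  note ctx = smooth_on_UNIV_D(2)[OF smooth_on_partials(1)[OF fx]]
  have dt: "((\<lambda>\<tau>. g (\<tau>, y)) has_vector_derivative d_t g (t, y)) (at t within S)"
    if "smooth_on UNIV g" for g t y S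
    using has_vector_derivative_comp_partials[OF that DERIV_ident DERIV_const]
    by (auto intro: has_vector_derivative_at_within)
  have dx: "((\<lambda>y. g (t, y)) has_vector_derivative d_x g (t, y)) (at y within S)"
    if "smooth_on UNIV g" for g t y S
    using has_vector_derivative_comp_partials[OF that DERIV_const DERIV_ident]
    by (auto intro: has_vector_derivative_at_within)
  \<comment> \<open>The lower limit lies to the left of \<open>x\<close>, so \<open>x\<close> is an
    interior point of \<open>{a..x + 1}\<close> and \<open>a \<le> y\<close> holds throughout that
    interval.\<close>
  define a where "a = x - 1"
  have ftc: "((\<lambda>\<eta>. d_x f (\<tau>, \<eta>)) has_integral (f (\<tau>, y) - f (\<tau>, a))) {a..y}" if "a \<le> y" for \<tau> y
    using that dx[OF f] by (intro fundamental_theorem_of_calculus) auto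
  have *: "d_t f (t, y) - d_t f (t, a) = integral {a..y} (\<lambda>\<eta>. d_t (d_x f) (t, \<eta>))"
    if "a \<le> y" for y
  proof -
    have "((\<lambda>\<tau>. integral (cbox a y) (\<lambda>\<eta>. d_x f (\<tau>, \<eta>))) has_vector_derivative
        integral (cbox a y) (\<lambda>\<eta>. d_t (d_x f) (t, \<eta>))) (at t within UNIV)"
    proof (rule leibniz_rule_vector_derivative)
      show "(\<lambda>\<eta>. d_x f (\<tau>, \<eta>)) integrable_on cbox a y" for \<tau>
        using ftc[OF that] by (auto simp: integrable_on_def)
      show "continuous_on (UNIV \<times> cbox a y) (\<lambda>(\<tau>, \<eta>). d_t (d_x f) (\<tau>, \<eta>))"
        using continuous_on_subset[OF ctx] by simp
    qed (use dt[OF fx] in auto)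
    moreover have "integral (cbox a y) (\<lambda>\<eta>. d_x f (\<tau>, \<eta>)) = f (\<tau>, y) - f (\<tau>, a)" for \<tau>
      using ftc[OF that] by (simp add: integral_unique)
    ultimately have "((\<lambda>\<tau>. f (\<tau>, y) - f (\<tau>, a)) has_vector_derivative
        integral {a..y} (\<lambda>\<eta>. d_t (d_x f) (t, \<eta>))) (at t)"
      by simp
    moreover have "((\<lambda>\<tau>. f (\<tau>, y) - f (\<tau>, a)) has_vector_derivative d_t f (t, y) - d_t f (t, a)) (at t)"
      by (intro has_vector_derivative_diff dt f)
    ultimately show ?thesis
      by (rule vector_derivative_unique_at[symmetric])
  qed
  have "((\<lambda>y. integral {a..y} (\<lambda>\<eta>. d_t (d_x f) (t, \<eta>))) has_vector_derivative d_t (d_x f) (t, x))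
      (at x within {a..x + 1})"
    by (rule integral_has_vector_derivative)
      (auto simp: a_def intro!: continuous_on_compose2[OF ctx] continuous_intros)
  moreover have "((\<lambda>y. integral {a..y} (\<lambda>\<eta>. d_t (d_x f) (t, \<eta>))) has_vector_derivative d_x (d_t f) (t, x))
      (at x within {a..x + 1})"
  proof (rule has_vector_derivative_transform)
    show "((\<lambda>y. d_t f (t, y) - d_t f (t, a)) has_vector_derivative d_x (d_t f) (t, x)) (at x within {a..x + 1})"
      using has_vector_derivative_diff[OF dx[OF ft] has_vector_derivative_const] by simp
  qed (use * in \<open>auto simp: a_def\<close>)
  ultimately show ?thesis
    using vector_derivative_unique_within_closed_interval[of a "x + 1" x]
    by (auto simp: a_def)
qed

text \<open>The multipliers of the representation have this shape: \<open>c\<close> complex,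
  \<open>g\<close> real. Complex powers of a positive base are included, with \<open>g\<close> a
  logarithm.\<close>

lemma has_vector_derivative_exp_of_real:
  fixes c :: complex
  assumes "(g has_real_derivative g') (at u)"
  shows "((\<lambda>u. exp (c * of_real (g u))) has_vector_derivative c * of_real g' * exp (c * of_real (g u))) (at u)"
proof -
  have "((\<lambda>u. c * of_real (g u)) has_vector_derivative c * of_real g') (at u)"
    using assms by (auto intro!: has_vector_derivative_mult_right has_vector_derivative_of_real)
  from field_vector_diff_chain_at[OF this DERIV_exp] show ?thesis
    by (simp add: o_def)
qed

section \<open>The group law in coordinates\<close>

lemma mat22_nth [simp]:
  "mat22 a b c d $ 1 $ 1 = a" "mat22 a b c d $ 1 $ 2 = b"
  "mat22 a b c d $ 2 $ 1 = c" "mat22 a b c d $ 2 $ 2 = d"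
  by (simp_all add: mat22_def)

lemma mat22_eq_iff: "A = mat22 a b c d \<longleftrightarrow> A$1$1 = a \<and> A$1$2 = b \<and> A$2$1 = c \<and> A$2$2 = d"
  by (auto simp: vec_eq_iff forall_2)

lemma mat22_mult:
  "mat22 a b c d ** mat22 a' b' c' d' =
    mat22 (a * a' + b * c') (a * b' + b * d') (c * a' + d * c') (c * b' + d * d')"
  by (simp add: mat22_eq_iff matrix_matrix_mult_def sum_2)

lemma mat_1_eq_mat22: "mat 1 = mat22 1 0 0 1"
  by (simp add: mat22_eq_iff mat_def)

text \<open>\<open>matrix_inv\<close> is a choice of inverse. The adjugate shows that a two-sided
  inverse exists, and cancelling with it on the left identifies the chosen one.\<close>

lemma matrix_inv_mat22:
  assumes "a * d - b * c = 1"
  shows "matrix_inv (mat22 a b c d) = mat22 d (- b) (- c) a"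
proof -
  let ?A = "mat22 a b c d" and ?B = "mat22 d (- b) (- c) a"
  have "?A ** ?B = mat 1" and BA: "?B ** ?A = mat 1"
    using assms by (simp_all add: mat22_mult mat_1_eq_mat22 algebra_simps)
  then have "?A ** matrix_inv ?A = mat 1"
    unfolding matrix_inv_def by (metis (mono_tags, lifting) someI_ex)
  then show ?thesis
    using BA by (metis matrix_mul_assoc matrix_mul_lid matrix_mul_rid)
qed

lemma mult_mp_group:
  "(g, e) \<otimes>\<^bsub>mp_group\<^esub> (g', e') = (g ** g', \<lambda>z\<in>upper_half_plane. e (moebius g' z) * e' z)"
  by (simp add: mp_group_def)

lemma one_mp_group: "\<one>\<^bsub>mp_group\<^esub> = (mat 1, \<lambda>z\<in>upper_half_plane. 1)"
  by (simp add: mp_group_def)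

lemma mult_jac_group:
  "(g, h) \<otimes>\<^bsub>jac_group\<^esub> (g', h') =
    (g \<otimes>\<^bsub>mp_group\<^esub> g', heis_act (matrix_inv (fst g')) h \<otimes>\<^bsub>heis_group\<^esub> h')"
  by (simp add: jac_group_def)

lemma mult_heis_group:
  "(v1, v2, v3) \<otimes>\<^bsub>heis_group\<^esub> (w1, w2, w3) = (v1 + w1, v2 + w2, v3 + w3 + v1 * w2 - v2 * w1)"
  by (simp add: heis_group_def)

lemma one_heis_group: "\<one>\<^bsub>heis_group\<^esub> = (0, 0, 0)"
  by (simp add: heis_group_def)

lemma heis_act_zero [simp]: "heis_act g (0, 0, 0) = (0, 0, 0)"
  by (simp add: heis_act_def)

text \<open>The inverse is a definite description, so uniqueness is checked by components: the
  matrix by cancellation, the function on the half plane pointwise, and the Heisenberg part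
  directly, since \<open>heis_act\<close> fixes the identity.\<close>

lemma inv_jac_group:
  assumes inv: "y \<in> carrier mp_group" "x \<otimes>\<^bsub>mp_group\<^esub> y = \<one>\<^bsub>mp_group\<^esub>" "y \<otimes>\<^bsub>mp_group\<^esub> x = \<one>\<^bsub>mp_group\<^esub>"
  shows "inv\<^bsub>jac_group\<^esub> (x, \<one>\<^bsub>heis_group\<^esub>) = (y, \<one>\<^bsub>heis_group\<^esub>)"
  unfolding m_inv_def
proof (rule the_equality)
  show "(y, \<one>\<^bsub>heis_group\<^esub>) \<in> carrier jac_group \<and>
    (x, \<one>\<^bsub>heis_group\<^esub>) \<otimes>\<^bsub>jac_group\<^esub> (y, \<one>\<^bsub>heis_group\<^esub>) = \<one>\<^bsub>jac_group\<^esub> \<and>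
    (y, \<one>\<^bsub>heis_group\<^esub>) \<otimes>\<^bsub>jac_group\<^esub> (x, \<one>\<^bsub>heis_group\<^esub>) = \<one>\<^bsub>jac_group\<^esub>"
    using inv by (simp add: mult_jac_group one_heis_group mult_heis_group)
      (simp add: jac_group_def heis_group_def)
next
  fix w
  assume w: "w \<in> carrier jac_group \<and>
    (x, \<one>\<^bsub>heis_group\<^esub>) \<otimes>\<^bsub>jac_group\<^esub> w = \<one>\<^bsub>jac_group\<^esub> \<and>
    w \<otimes>\<^bsub>jac_group\<^esub> (x, \<one>\<^bsub>heis_group\<^esub>) = \<one>\<^bsub>jac_group\<^esub>"
  obtain g e where x: "x = (g, e)" by (cases x)
  obtain g' e' where y: "y = (g', e')" by (cases y)
  obtain k d v1 v2 v3 where w_eq: "w = ((k, d), (v1, v2, v3))" by (metis surj_pair)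
  have one: "\<one>\<^bsub>jac_group\<^esub> = (\<one>\<^bsub>mp_group\<^esub>, \<one>\<^bsub>heis_group\<^esub>)"
    by (simp add: jac_group_def)
  have wx: "(k, d) \<in> carrier mp_group" "(g, e) \<otimes>\<^bsub>mp_group\<^esub> (k, d) = \<one>\<^bsub>mp_group\<^esub>"
    using w by (auto simp: w_eq x one mult_jac_group) (auto simp: jac_group_def)
  have v: "(v1, v2, v3) = \<one>\<^bsub>heis_group\<^esub>"
    using w by (auto simp: w_eq x one mult_jac_group one_heis_group mult_heis_group)
  have "g ** k = mat 1" "g ** g' = mat 1" "g' ** g = mat 1"
    using wx inv by (simp_all add: x y mult_mp_group one_mp_group)
  then have k: "k = g'" by (metis matrix_mul_assoc matrix_mul_lid matrix_mul_rid)
  \<comment> \<open>On the half plane both values have product 1 with the same factor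
    \<open>e (moebius g' z)\<close>, which is therefore nonzero. Elsewhere both functions take the
    default value of extensional functions.\<close>
  have "d z = e' z" for z
  proof (cases "z \<in> upper_half_plane")
    case True
    have "e (moebius g' z) * d z = 1" "e (moebius g' z) * e' z = 1"
      using wx(2) inv(2) True by (auto simp: x y k mult_mp_group one_mp_group restrict_def fun_eq_iff split: if_splits)
    then show ?thesis by (metis mult_cancel_left mult_zero_left zero_neq_one)
  next
    case False
    then show ?thesis using wx(1) inv(1) by (auto simp: y mp_group_def extensional_def)
  qed
  then show "w = (y, \<one>\<^bsub>heis_group\<^esub>)" using v k by (auto simp: w_eq y)
qed

section \<open>The upper half plane and the double cover\<close>

lemma open_upper_half_plane: "open upper_half_plane"
  unfolding upper_half_plane_def by (simp add: open_halfspace_Im_gt)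

text \<open>The imaginary part is \<open>u * Im z\<close>, nonzero unless \<open>u = 0\<close>,
  where the value is 1. This keeps \<open>csqrt\<close> off its branch cut, where it is
  holomorphic.\<close>

lemma upper_half_plane_affine_notin_nonpos_Reals:
  assumes "z \<in> upper_half_plane"
  shows "of_real u * z + 1 \<notin> \<real>\<^sub>\<le>\<^sub>0"
  using assms by (auto simp: complex_nonpos_Reals_iff upper_half_plane_def)

lemma carrier_mp_groupI:
  fixes g :: "real^2^2"
  assumes "det g = 1" "f holomorphic_on upper_half_plane"
    and "\<And>z. z \<in> upper_half_plane \<Longrightarrow> (f z)\<^sup>2 = of_real (g$2$1) * z + of_real (g$2$2)"
  shows "(g, \<lambda>z\<in>upper_half_plane. f z) \<in> carrier mp_group"
proof -
  have "(\<lambda>z\<in>upper_half_plane. f z) holomorphic_on upper_half_plane"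
    using assms(2) by (rule holomorphic_transform) simp
  then show ?thesis
    using assms by (simp add: mp_group_def holomorphic_imp_smooth_on[OF open_upper_half_plane])
qed

lemma exp_in_carrier:
  "exp_h u \<in> carrier mp_group" "exp_ep u \<in> carrier mp_group" "exp_em u \<in> carrier mp_group"
proof -
  have "(exp (- u / 2))\<^sup>2 = exp (- u)"
    by (simp flip: exp_double)
  then show "exp_h u \<in> carrier mp_group"
    unfolding exp_h_def
    by (intro carrier_mp_groupI holomorphic_intros) (simp_all add: det_2 flip: exp_add of_real_power)
  show "exp_ep u \<in> carrier mp_group"
    unfolding exp_ep_def by (intro carrier_mp_groupI holomorphic_intros) (simp_all add: det_2)
  show "exp_em u \<in> carrier mp_group"
    unfolding exp_em_def
    by (intro carrier_mp_groupI holomorphic_intros upper_half_plane_affine_notin_nonpos_Reals)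
      (simp_all add: det_2)
qed

lemma N_elem_in_carrier: "N_elem t x \<in> carrier jac_group"
  using exp_in_carrier(2)[of t] by (simp add: N_elem_def exp_ep_def jac_group_def heis_group_def)

text \<open>The imaginary part forces \<open>g$2$1 = 0\<close>, then the real part
  \<open>g$2$2 = 0\<close>; a zero bottom row contradicts determinant 1.\<close>

lemma moebius_denominator_neq_0:
  fixes g :: "real^2^2"
  assumes "det g = 1" "z \<in> upper_half_plane"
  shows "of_real (g$2$1) * z + of_real (g$2$2) \<noteq> 0"
proof
  assume "of_real (g$2$1) * z + of_real (g$2$2) = 0"
  then have "g$2$1 * Im z = 0" "g$2$1 * Re z + g$2$2 = 0"
    by (simp_all add: complex_eq_iff)
  then show False
    using assms by (auto simp: upper_half_plane_def det_2)
qed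

text \<open>The imaginary part of the image is \<open>det g * Im z\<close> divided by the squared
  modulus of the denominator.\<close>

lemma moebius_in_upper_half_plane:
  fixes g :: "real^2^2"
  assumes "det g = 1" "z \<in> upper_half_plane"
  shows "moebius g z \<in> upper_half_plane"
proof -
  let ?w = "of_real (g$2$1) * z + of_real (g$2$2)"
  have "Im (moebius g z) = det g * Im z / ((Re ?w)\<^sup>2 + (Im ?w)\<^sup>2)"
    by (simp add: moebius_def Im_divide det_2) (simp add: algebra_simps)
  also have "\<dots> > 0"
    using moebius_denominator_neq_0[OF assms] assms
    unfolding complex_neq_0[of ?w] by (simp add: upper_half_plane_def)
  finally show ?thesis by (simp add: upper_half_plane_def)
qed

text \<open>Expanding the outer fraction by the denominator \<open>?w\<close> of
  \<open>moebius h z\<close> clears the nested fraction and leaves the entries of the matrix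
  product.\<close>

lemma moebius_mult:
  fixes g h :: "real^2^2"
  assumes "det h = 1" "z \<in> upper_half_plane"
  shows "moebius (g ** h) z = moebius g (moebius h z)"
proof -
  let ?w = "of_real (h$2$1) * z + of_real (h$2$2)"
  have "?w \<noteq> 0" using assms by (rule moebius_denominator_neq_0)
  then have eq: "of_real a * moebius h z + of_real b =
      ((of_real a * (of_real (h$1$1) * z + of_real (h$1$2)) + of_real b * ?w) / ?w)" for a b
    by (simp add: moebius_def field_simps)
  have "moebius g (moebius h z) =
      (of_real (g$1$1) * (of_real (h$1$1) * z + of_real (h$1$2)) + of_real (g$1$2) * ?w) /
      (of_real (g$2$1) * (of_real (h$1$1) * z + of_real (h$1$2)) + of_real (g$2$2) * ?w)"
    unfolding moebius_def[of g] eq using \<open>?w \<noteq> 0\<close> by simp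
  then show ?thesis
    by (simp add: moebius_def matrix_matrix_mult_def sum_2 algebra_simps)
qed

text \<open>In the second component this is the action law of \<open>moebius\<close>; the
  determinants ensure that the inner points stay in the half plane, where the restrictions have no
  effect.\<close>

lemma mult_mp_group_assoc:
  assumes "det h = 1" "det k = 1"
  shows "((g, e) \<otimes>\<^bsub>mp_group\<^esub> (h, e')) \<otimes>\<^bsub>mp_group\<^esub> (k, e'') =
    (g, e) \<otimes>\<^bsub>mp_group\<^esub> ((h, e') \<otimes>\<^bsub>mp_group\<^esub> (k, e''))"
  using assms
  by (auto simp: mult_mp_group matrix_mul_assoc moebius_mult moebius_in_upper_half_plane intro!: restrict_ext)

lemma mult_jac_group_mp:
  "(g, \<one>\<^bsub>heis_group\<^esub>) \<otimes>\<^bsub>jac_group\<^esub> (k, h) = (g \<otimes>\<^bsub>mp_group\<^esub> k, h)"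
  by (cases h) (simp add: mult_jac_group one_heis_group mult_heis_group)

lemma exp_h_add: "exp_h u \<otimes>\<^bsub>mp_group\<^esub> exp_h v = exp_h (u + v)"
proof -
  have "moebius (mat22 (exp v) 0 0 (exp (- v))) z \<in> upper_half_plane" if "z \<in> upper_half_plane" for z
    using that by (intro moebius_in_upper_half_plane) (simp_all add: det_2 flip: exp_add)
  then show ?thesis
    by (auto simp: exp_h_def mult_mp_group mat22_mult simp flip: exp_add of_real_mult
        intro!: restrict_ext arg_cong[where f = exp])
qed

lemma exp_ep_add: "exp_ep u \<otimes>\<^bsub>mp_group\<^esub> exp_ep v = exp_ep (u + v)"
  by (auto simp: exp_ep_def mult_mp_group mat22_mult moebius_def upper_half_plane_def add.commute intro!: restrict_ext)

text \<open>With \<open>w = 1 - u * z\<close> the argument of the first root becomes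
  \<open>1 / w\<close>, because \<open>u * z + w = 1\<close>. Off the branch cut,
  \<open>csqrt\<close> commutes with inversion.\<close>

lemma exp_em_inverse: "exp_em u \<otimes>\<^bsub>mp_group\<^esub> exp_em (- u) = \<one>\<^bsub>mp_group\<^esub>"
proof -
  have "csqrt (of_real u * moebius (mat22 1 0 (- u) 1) z + 1) * csqrt (of_real (- u) * z + 1) = 1"
    if z: "z \<in> upper_half_plane" for z
  proof -
    define w where "w = of_real (- u) * z + 1"
    have w: "w \<notin> \<real>\<^sub>\<le>\<^sub>0" "w \<noteq> 0"
      using upper_half_plane_affine_notin_nonpos_Reals[OF z, of "- u"] by (auto simp: w_def)
    have "of_real u * moebius (mat22 1 0 (- u) 1) z + 1 = of_real u * (z / w) + 1"
      by (simp add: moebius_def w_def)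
    also have "\<dots> = inverse w"
      using w(2) by (simp add: field_simps) (simp add: w_def)
    finally show ?thesis
      unfolding w_def[symmetric] using w by (simp add: csqrt_inverse)
  qed
  moreover have "moebius (mat22 1 0 (- u) 1) z \<in> upper_half_plane" if "z \<in> upper_half_plane" for z
    using that by (intro moebius_in_upper_half_plane) (simp_all add: det_2)
  ultimately show ?thesis
    by (auto simp: exp_em_def one_mp_group mult_mp_group mat22_mult mat_1_eq_mat22 intro!: restrict_ext)
qed

lemma exp_h_0: "exp_h 0 = \<one>\<^bsub>mp_group\<^esub>" and exp_ep_0: "exp_ep 0 = \<one>\<^bsub>mp_group\<^esub>"
  by (simp_all add: exp_h_def exp_ep_def one_mp_group mat_1_eq_mat22)

section \<open>Translating \<open>N_elem t x\<close> by the one-parameter subgroups\<close>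

lemma left_transl_exp_h:
  "left_transl (exp_h u, \<one>\<^bsub>heis_group\<^esub>) \<phi> y = \<phi> ((exp_h (- u), \<one>\<^bsub>heis_group\<^esub>) \<otimes>\<^bsub>jac_group\<^esub> y)"
  by (simp add: left_transl_def inv_jac_group[of "exp_h (- u)"] exp_in_carrier exp_h_add exp_h_0)

lemma left_transl_exp_ep:
  "left_transl (exp_ep u, \<one>\<^bsub>heis_group\<^esub>) \<phi> y = \<phi> ((exp_ep (- u), \<one>\<^bsub>heis_group\<^esub>) \<otimes>\<^bsub>jac_group\<^esub> y)"
  by (simp add: left_transl_def inv_jac_group[of "exp_ep (- u)"] exp_in_carrier exp_ep_add exp_ep_0)

lemma left_transl_exp_em:
  "left_transl (exp_em u, \<one>\<^bsub>heis_group\<^esub>) \<phi> y = \<phi> ((exp_em (- u), \<one>\<^bsub>heis_group\<^esub>) \<otimes>\<^bsub>jac_group\<^esub> y)"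
  using exp_em_inverse[of u] exp_em_inverse[of "- u"]
  by (simp add: left_transl_def inv_jac_group[of "exp_em (- u)"] exp_in_carrier)

lemma exp_ep_mult_N_elem:
  "(exp_ep u, \<one>\<^bsub>heis_group\<^esub>) \<otimes>\<^bsub>jac_group\<^esub> N_elem t x = N_elem (u + t) x"
  using exp_ep_add[of u t] by (simp add: N_elem_def mult_jac_group_mp exp_ep_def)

text \<open>The instance of associativity needed to apply the action of \<open>exp_h\<close>
  twice.\<close>

lemma exp_h_mult_exp_h_mult_N_elem:
  "(exp_h u, \<one>\<^bsub>heis_group\<^esub>) \<otimes>\<^bsub>jac_group\<^esub> ((exp_h v, \<one>\<^bsub>heis_group\<^esub>) \<otimes>\<^bsub>jac_group\<^esub> N_elem t x) =
    (exp_h (u + v), \<one>\<^bsub>heis_group\<^esub>) \<otimes>\<^bsub>jac_group\<^esub> N_elem t x"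
proof -
  have "exp_h u \<otimes>\<^bsub>mp_group\<^esub> (exp_h v \<otimes>\<^bsub>mp_group\<^esub> exp_ep t) = exp_h (u + v) \<otimes>\<^bsub>mp_group\<^esub> exp_ep t"
    unfolding exp_h_add[symmetric] unfolding exp_h_def exp_ep_def
    by (rule mult_mp_group_assoc[symmetric]) (simp_all add: det_2 flip: exp_add)
  then show ?thesis by (simp add: N_elem_def mult_jac_group_mp exp_ep_def)
qed

text \<open>Conjugation by the diagonal element scales \<open>t\<close> by
  \<open>exp (2 * u)\<close> and \<open>x\<close> by \<open>exp u\<close>; the diagonal element
  itself is the parabolic factor with \<open>a = exp u\<close>.\<close>

lemma exp_h_mult_N_elem:
  "(exp_h u, \<one>\<^bsub>heis_group\<^esub>) \<otimes>\<^bsub>jac_group\<^esub> N_elem t x =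
    N_elem (exp (2 * u) * t) (exp u * x) \<otimes>\<^bsub>jac_group\<^esub> pbar 0 (exp u) 0 0 0"
proof -
  have "moebius (mat22 1 t 0 1) z \<in> upper_half_plane"
    "moebius (mat22 (exp u) 0 0 (exp (- u))) z \<in> upper_half_plane" if "z \<in> upper_half_plane" for z
    using that by (intro moebius_in_upper_half_plane; simp add: det_2 flip: exp_add)+
  moreover have exp_eq: "exp (2 * u) * t * exp (- u) = exp u * t"
    by (simp add: mult.assoc mult.left_commute[of "exp (2 * u)"] mult.commute[of "exp u"] flip: exp_add)
  ultimately show ?thesis
    by (auto simp: N_elem_def pbar_def mult_jac_group mult_heis_group one_heis_group exp_h_def
        mult_mp_group mat22_mult matrix_inv_mat22 heis_act_def exp_minus[symmetric] powr_def
        exp_add[symmetric] exp_eq intro!: restrict_ext)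
qed

text \<open>The matrix product has bottom row \<open>(u, d)\<close>, which forces
  \<open>a = 1 / d\<close>, \<open>c = u\<close> and the new first coordinate \<open>t / d\<close>.
  In the Heisenberg part, \<open>v = u * x / d\<close> cancels the second coordinate created by the
  inverse matrix, and \<open>w = - x * v\<close> cancels the resulting commutator term. Positivity
  of \<open>d\<close> permits \<open>j = 0\<close>.\<close>

lemma exp_em_mult_N_elem:
  assumes d: "d = 1 + u * t" "d > 0"
  shows "(exp_em u, \<one>\<^bsub>heis_group\<^esub>) \<otimes>\<^bsub>jac_group\<^esub> N_elem t x =
    N_elem (t / d) (x / d) \<otimes>\<^bsub>jac_group\<^esub> pbar 0 (1 / d) u (u * x / d) (- u * x\<^sup>2 / d)"
proof -
  \<comment> \<open>Equality of the second components: the argument is \<open>u * z + d\<close>, and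
    the positive factor \<open>d\<close>, having argument 0, can be pulled out of the principal
    root.\<close>
  have "csqrt (of_real u * moebius (mat22 1 t 0 1) z + 1) =
      of_real ((1 / d) powr (- 1 / 2)) * csqrt (of_real (u / d) * z + 1)" for z
  proof -
    have "of_real u * moebius (mat22 1 t 0 1) z + 1 = of_real d * (of_real (u / d) * z + 1)"
      using d(2) by (simp add: distrib_left moebius_def) (simp add: d)
    moreover have "csqrt (of_real d * w) = of_real (sqrt d) * csqrt w" for w
      using Arg_bounded[of w] d(2) by (subst csqrt_mult) (auto simp: Arg_of_real)
    moreover have "(1 / d) powr (- 1 / 2) = sqrt d"
      using d(2) by (simp add: powr_half_sqrt powr_minus powr_divide)
    ultimately show ?thesis by simp
  qed
  moreover have "moebius (mat22 (1 / d) 0 u d) z \<in> upper_half_plane"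
    "moebius (mat22 1 t 0 1) z \<in> upper_half_plane" if "z \<in> upper_half_plane" for z
    using that d(2) by (intro moebius_in_upper_half_plane; simp add: det_2)+
  moreover have "1 / d + t / d * u = 1" "t * u + 1 = d"
    using d by (simp_all add: field_simps)
  ultimately show ?thesis using d(2)
    by (auto simp: N_elem_def pbar_def mult_jac_group mult_heis_group one_heis_group exp_em_def
        mult_mp_group mat22_mult matrix_inv_mat22 heis_act_def mult_ac power2_eq_square intro!: restrict_ext)
qed

section \<open>The derived action\<close>

text \<open>Equivariance under the parabolic factor with \<open>a = exp (- u)\<close>; the inverse
  of the character is the multiplier.\<close>

lemma ind_rep_exp_h:
  assumes "\<phi> \<in> ind_rep q r s"
  shows "\<phi> ((exp_h (- u), \<one>\<^bsub>heis_group\<^esub>) \<otimes>\<^bsub>jac_group\<^esub> N_elem t x) =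
    exp (r * of_real u) * restr_N \<phi> (exp (- 2 * u) * t, exp (- u) * x)"
proof -
  have "\<phi> ((exp_h (- u), \<one>\<^bsub>heis_group\<^esub>) \<otimes>\<^bsub>jac_group\<^esub> N_elem t x) =
      inverse (chi q r s 0 (exp (- u)) 0) * \<phi> (N_elem (exp (- 2 * u) * t) (exp (- u) * x))"
    using assms by (simp add: exp_h_mult_N_elem ind_rep_def N_elem_in_carrier)
  then show ?thesis
    by (simp add: chi_def restr_N_def powr_def Ln_of_real exp_minus[symmetric] del: of_real_exp)
qed

text \<open>Here the parabolic factor has \<open>a = 1 / d\<close> and
  \<open>w = u * x\<^sup>2 / d\<close>, so the multiplier is the power \<open>d\<close> to the
  \<open>r\<close> times an exponential, written in a form ready to be differentiated.\<close>

lemma ind_rep_exp_em: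
  assumes "\<phi> \<in> ind_rep q r s" and d: "d = 1 - u * t" "d > 0"
  shows "\<phi> ((exp_em (- u), \<one>\<^bsub>heis_group\<^esub>) \<otimes>\<^bsub>jac_group\<^esub> N_elem t x) =
    exp (r * of_real (ln d)) * exp (- s * of_real (u * x\<^sup>2 / d)) * restr_N \<phi> (t / d, x / d)"
proof -
  have "\<phi> ((exp_em (- u), \<one>\<^bsub>heis_group\<^esub>) \<otimes>\<^bsub>jac_group\<^esub> N_elem t x) =
      inverse (chi q r s 0 (1 / d) (u * x\<^sup>2 / d)) * \<phi> (N_elem (t / d) (x / d))"
    using assms exp_em_mult_N_elem[of d "- u" t x] by (simp add: ind_rep_def N_elem_in_carrier)
  then show ?thesis
    using d(2) by (simp add: chi_def restr_N_def powr_def Ln_of_real ln_div flip: exp_minus of_real_divide)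
qed

text \<open>Iterating the derived action of \<open>exp_h\<close> leaves the subgroup of the \<open>N_elem t x\<close>, so its
  values are needed at the translates by \<open>exp_h (- u)\<close> as well.\<close>

lemma derived_act_exp_h:
  assumes \<phi>: "\<phi> \<in> ind_rep q r s" and f: "f = restr_N \<phi>" "smooth_on UNIV f"
  defines "H \<equiv> \<lambda>t x. r * f (t, x) - 2 * of_real t * d_t f (t, x) - of_real x * d_x f (t, x)"
  shows "derived_act exp_h \<phi> ((exp_h (- u), \<one>\<^bsub>heis_group\<^esub>) \<otimes>\<^bsub>jac_group\<^esub> N_elem t x) =
    exp (r * of_real u) * H (exp (- 2 * u) * t) (exp (- u) * x)"
proof -
  \<comment> \<open>\<open>(T v, X v)\<close> are the coordinates reached after translating by
    \<open>exp_h (- v)\<close> on top of \<open>exp_h (- u)\<close>.\<close>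
  define T where "T = (\<lambda>v. exp (- 2 * (v + u)) * t)"
  define X where "X = (\<lambda>v. exp (- (v + u)) * x)"
  have T: "(T has_real_derivative - 2 * T 0) (at 0)" and X: "(X has_real_derivative - X 0) (at 0)"
    unfolding T_def X_def by (auto intro!: derivative_eq_intros)
  have E: "((\<lambda>v. exp (r * of_real (v + u))) has_vector_derivative r * exp (r * of_real u)) (at 0)"
    using has_vector_derivative_exp_of_real[OF DERIV_add[OF DERIV_ident DERIV_const], where u = 0 and c = r]
    by simp
  have "((\<lambda>v. exp (r * of_real (v + u)) * f (T v, X v)) has_vector_derivative
      exp (r * of_real u) * H (T 0) (X 0)) (at 0)"
    by (rule has_vector_derivative_eq_rhs[OF has_vector_derivative_mult[OF E
          has_vector_derivative_comp_partials[OF f(2) T X]]])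
      (simp add: H_def algebra_simps)
  moreover have "left_transl (exp_h v, \<one>\<^bsub>heis_group\<^esub>) \<phi>
      ((exp_h (- u), \<one>\<^bsub>heis_group\<^esub>) \<otimes>\<^bsub>jac_group\<^esub> N_elem t x) =
      exp (r * of_real (v + u)) * f (T v, X v)" for v
    using ind_rep_exp_h[OF \<phi>, of "v + u" t x]
    by (simp add: left_transl_exp_h exp_h_mult_exp_h_mult_N_elem f(1) T_def X_def)
  ultimately show ?thesis
    by (simp add: derived_act_def vector_derivative_at T_def X_def)
qed

text \<open>At \<open>u = 0\<close> the power of \<open>D\<close> contributes
  \<open>- r * t\<close>, the exponential \<open>- s * x\<^sup>2\<close>, and the moving point has
  velocity \<open>(t\<^sup>2, t * x)\<close>.\<close>

lemma derived_act_exp_em: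
  assumes \<phi>: "\<phi> \<in> ind_rep q r s" and f: "f = restr_N \<phi>" "smooth_on UNIV f"
  shows "derived_act exp_em \<phi> (N_elem t x) =
    of_real t ^ 2 * d_t f (t, x) + of_real t * of_real x * d_x f (t, x)
      - (s * of_real x ^ 2 + r * of_real t) * f (t, x)"
proof -
  define D where "D = (\<lambda>u. 1 - u * t)"
  have D: "(D has_real_derivative - t) (at 0)" "D 0 = 1"
    unfolding D_def by (auto intro!: derivative_eq_intros)
  have "((\<lambda>u. exp (r * of_real (ln (D u))) * exp (- s * of_real (u * x\<^sup>2 / D u)) * f (t / D u, x / D u))
      has_vector_derivative (of_real t ^ 2 * d_t f (t, x) + of_real t * of_real x * d_x f (t, x)
      - (s * of_real x ^ 2 + r * of_real t) * f (t, x))) (at 0)"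
  proof -
    have "((\<lambda>u. t / D u) has_real_derivative t\<^sup>2) (at 0)" "((\<lambda>u. x / D u) has_real_derivative t * x) (at 0)"
      "((\<lambda>u. ln (D u)) has_real_derivative - t) (at 0)"
      "((\<lambda>u. u * x\<^sup>2 / D u) has_real_derivative x\<^sup>2) (at 0)"
      using D(2) by (auto intro!: derivative_eq_intros D(1) simp: power2_eq_square)
    then show ?thesis
      by (intro has_vector_derivative_eq_rhs[OF has_vector_derivative_mult[OF has_vector_derivative_mult[OF
          has_vector_derivative_exp_of_real has_vector_derivative_exp_of_real]
          has_vector_derivative_comp_partials[OF f(2)]]])
        (auto simp: D(2) algebra_simps)
  qed
  then have "((\<lambda>u. left_transl (exp_em u, \<one>\<^bsub>heis_group\<^esub>) \<phi> (N_elem t x))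
      has_vector_derivative (of_real t ^ 2 * d_t f (t, x) + of_real t * of_real x * d_x f (t, x)
      - (s * of_real x ^ 2 + r * of_real t) * f (t, x))) (at 0)"
  \<comment> \<open>The factorisation behind the multiplier formula is available only where
    \<open>D u > 0\<close>; this is an open set containing 0, which suffices for a derivative at
    0.\<close>
  proof (rule has_vector_derivative_transform_within_open)
    show "open {u. 0 < D u}"
      unfolding D_def by (intro open_Collect_less continuous_intros)
    show "exp (r * of_real (ln (D u))) * exp (- s * of_real (u * x\<^sup>2 / D u)) * f (t / D u, x / D u) =
        left_transl (exp_em u, \<one>\<^bsub>heis_group\<^esub>) \<phi> (N_elem t x)" if "u \<in> {u. 0 < D u}" for u
      using that by (simp add: left_transl_exp_em ind_rep_exp_em[OF \<phi>] D_def f(1))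
  qed (simp add: D(2))
  then show ?thesis by (simp add: derived_act_def vector_derivative_at)
qed

text \<open>Half of the squared \<open>exp_h\<close> action contributes \<open>2 * t\<^sup>2\<close>
  times the second \<open>t\<close>-derivative and \<open>2 * t * x\<close> times the mixed one;
  twice the composite of \<open>exp_ep\<close> and \<open>exp_em\<close> contributes their
  negatives.\<close>

lemma casimir_N_elem:
  assumes \<phi>: "\<phi> \<in> ind_rep q r s" and f: "f = restr_N \<phi>" "smooth_on UNIV f"
  shows "casimir \<phi> (N_elem t x) =
    1 / 2 * (4 * s * of_real x ^ 2 * d_t f (t, x) + of_real x ^ 2 * d_x (d_x f) (t, x)
      - (1 + 2 * r) * of_real x * d_x f (t, x) + r * (r + 2) * f (t, x))"
proof -
  note ft = smooth_on_partials(1)[OF f(2)] and fx = smooth_on_partials(2)[OF f(2)]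
  have N: "(exp_h 0, \<one>\<^bsub>heis_group\<^esub>) \<otimes>\<^bsub>jac_group\<^esub> N_elem t x = N_elem t x"
    using exp_ep_mult_N_elem[of 0 t x] by (simp add: exp_h_0 exp_ep_0)
  have h: "derived_act exp_h \<phi> (N_elem t x) = r * f (t, x) - 2 * of_real t * d_t f (t, x) - of_real x * d_x f (t, x)"
    using derived_act_exp_h[OF \<phi> f, of 0 t x] by (simp add: N)

  define T where "T = (\<lambda>v. exp (- 2 * v) * t)"
  define X where "X = (\<lambda>v. exp (- v) * x)"
  have T: "(T has_real_derivative - 2 * t) (at 0)" and X: "(X has_real_derivative - x) (at 0)"
    unfolding T_def X_def by (auto intro!: derivative_eq_intros)
  have TX: "T 0 = t" "X 0 = x" by (simp_all add: T_def X_def)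
  note comp = has_vector_derivative_comp_partials[OF _ T X, unfolded TX]
  note T' = has_vector_derivative_of_real[OF T]
  note X' = has_vector_derivative_of_real[OF X]
  have E: "((\<lambda>v. exp (r * of_real v)) has_vector_derivative r) (at 0)"
    using has_vector_derivative_exp_of_real[OF DERIV_ident, where u = 0 and c = r] by simp
  \<comment> \<open>This differentiates the first \<open>exp_h\<close> derivative along the second
    translation. Both mixed partials arise and are merged by their symmetry.\<close>
  have "((\<lambda>u. exp (r * of_real u) * (r * f (T u, X u) - 2 * (of_real (T u) * d_t f (T u, X u))
      - of_real (X u) * d_x f (T u, X u))) has_vector_derivative
      (r * (r * f (t, x) - 2 * of_real t * d_t f (t, x) - of_real x * d_x f (t, x))
      + r * (- 2 * of_real t * d_t f (t, x) - of_real x * d_x f (t, x))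
      + 4 * of_real t * d_t f (t, x) + of_real x * d_x f (t, x)
      + 4 * of_real t ^ 2 * d_t (d_t f) (t, x) + 4 * of_real t * of_real x * d_t (d_x f) (t, x)
      + of_real x ^ 2 * d_x (d_x f) (t, x))) (at 0)"
    by (rule has_vector_derivative_eq_rhs[OF has_vector_derivative_mult[OF E
          has_vector_derivative_diff[OF has_vector_derivative_diff[OF
            has_vector_derivative_mult_right[OF comp[OF f(2)]]
            has_vector_derivative_mult_right[OF has_vector_derivative_mult[OF T' comp[OF ft]]]]
            has_vector_derivative_mult[OF X' comp[OF fx]]]]])
      (simp add: TX smooth_on_imp_partials_commute[OF f(2), symmetric] algebra_simps power2_eq_square)
  then have hh: "derived_act exp_h (derived_act exp_h \<phi>) (N_elem t x) =
      r * (r * f (t, x) - 2 * of_real t * d_t f (t, x) - of_real x * d_x f (t, x))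
      + r * (- 2 * of_real t * d_t f (t, x) - of_real x * d_x f (t, x))
      + 4 * of_real t * d_t f (t, x) + of_real x * d_x f (t, x)
      + 4 * of_real t ^ 2 * d_t (d_t f) (t, x) + 4 * of_real t * of_real x * d_t (d_x f) (t, x)
      + of_real x ^ 2 * d_x (d_x f) (t, x)"
    unfolding derived_act_def[of exp_h "derived_act exp_h \<phi>"]
    by (simp add: left_transl_exp_h derived_act_exp_h[OF \<phi> f] vector_derivative_at T_def X_def mult.assoc)

  \<comment> \<open>Translation by \<open>exp_ep (- u)\<close> only shifts \<open>t\<close>, so the
    values of the inner \<open>exp_em\<close> derivative at the points \<open>N_elem t x\<close>
    suffice.\<close>
  define S where "S = (\<lambda>u. - u + t)"
  have S: "(S has_real_derivative - 1) (at 0)" "S 0 = t"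
    by (auto simp: S_def intro!: derivative_eq_intros)
  note S' = has_vector_derivative_of_real[OF S(1)]
  note comp = has_vector_derivative_comp_partials[OF _ S(1) DERIV_const[where k = x], unfolded S(2)]
  have "((\<lambda>u. (of_real (S u) * (of_real (S u) * d_t f (S u, x)) + of_real (S u) * (of_real x * d_x f (S u, x)))
      - (s * of_real x ^ 2 * f (S u, x) + r * (of_real (S u) * f (S u, x)))) has_vector_derivative
      (- 2 * of_real t * d_t f (t, x) - of_real t ^ 2 * d_t (d_t f) (t, x)
      - of_real x * d_x f (t, x) - of_real t * of_real x * d_t (d_x f) (t, x)
      + (s * of_real x ^ 2 + r * of_real t) * d_t f (t, x) + r * f (t, x))) (at 0)"
    by (rule has_vector_derivative_eq_rhs[OF has_vector_derivative_diff[OF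
          has_vector_derivative_add[OF has_vector_derivative_mult[OF S' has_vector_derivative_mult[OF S' comp[OF ft]]]
            has_vector_derivative_mult[OF S' has_vector_derivative_mult_right[OF comp[OF fx]]]]
          has_vector_derivative_add[OF has_vector_derivative_mult_right[OF comp[OF f(2)]]
            has_vector_derivative_mult_right[OF has_vector_derivative_mult[OF S' comp[OF f(2)]]]]]])
      (simp add: S(2) algebra_simps power2_eq_square)
  then have ee: "derived_act exp_ep (derived_act exp_em \<phi>) (N_elem t x) =
      - 2 * of_real t * d_t f (t, x) - of_real t ^ 2 * d_t (d_t f) (t, x)
      - of_real x * d_x f (t, x) - of_real t * of_real x * d_t (d_x f) (t, x)
      + (s * of_real x ^ 2 + r * of_real t) * d_t f (t, x) + r * f (t, x)"
    unfolding derived_act_def[of exp_ep]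
    by (intro vector_derivative_at)
      (simp add: left_transl_exp_ep exp_ep_mult_N_elem derived_act_exp_em[OF \<phi> f] S_def power2_eq_square distrib_right mult.assoc)
  show ?thesis
    unfolding casimir_def h hh ee by (simp add: field_simps power2_eq_square)
qed

section \<open>The Casimir operator on the non-compact picture and its kernel\<close>

text \<open>The preimage chosen by \<open>inv_into\<close> enters the formula only through its
  restriction \<open>f\<close>, so the choice does not affect the result.\<close>

lemma Omega_eq:
  assumes "f \<in> noncompact q r s"
  shows "Omega q r s f (t, x) =
    1 / 2 * (4 * s * of_real x ^ 2 * d_t f (t, x) + of_real x ^ 2 * d_x (d_x f) (t, x)
      - (1 + 2 * r) * of_real x * d_x f (t, x) + r * (r + 2) * f (t, x))"
proof -
  define \<phi> where "\<phi> = inv_into (ind_rep q r s) restr_N f"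
  have "f \<in> restr_N ` ind_rep q r s" and f: "smooth_on UNIV f"
    using assms by (auto simp: noncompact_def)
  then have "\<phi> \<in> ind_rep q r s" "f = restr_N \<phi>"
    unfolding \<phi>_def by (simp_all add: inv_into_into f_inv_into_f)
  from casimir_N_elem[OF this f] show ?thesis
    by (simp add: Omega_def transport_def restr_N_def flip: \<phi>_def)
qed

text \<open>At these parameters \<open>1 + 2 * r = 0\<close> removes the first-order term in
  \<open>x\<close>, \<open>4 * s = 2 * \<i>\<close> gives the coefficient in \<open>Box\<close>, and
  the zero-order term is subtracted in \<open>Omega'\<close>.\<close>

lemma Omega'_eq_Box:
  assumes "f \<in> noncompact q (- 1 / 2) (\<i> / 2)"
  shows "Omega' q (- 1 / 2) (\<i> / 2) f (t, x) = of_real x ^ 2 * Box f (t, x)"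
  unfolding Omega'_def Omega_eq[OF assms] Box_def by (simp add: algebra_simps)

text \<open>Both values are limits at 0 of the same function off 0, and limits are unique because 0
  is not isolated.\<close>

lemma eq_at_zero_if_eq_off_zero:
  fixes g h :: "real \<Rightarrow> complex"
  assumes "continuous_on UNIV g" "continuous_on UNIV h" "\<And>x. x \<noteq> 0 \<Longrightarrow> g x = h x"
  shows "g 0 = h 0"
proof (rule tendsto_unique)
  show "(g \<longlongrightarrow> g 0) (at 0)" "(g \<longlongrightarrow> h 0) (at 0)"
    using assms Lim_transform_eventually[of h "h 0" "at 0" g]
    by (auto simp: continuous_on_def eventually_at_filter)
qed simp

lemma continuous_on_Box:
  assumes "smooth_on UNIV f"
  shows "continuous_on UNIV (Box f)"
  unfolding Box_def
  by (intro continuous_intros smooth_on_UNIV_D(2) smooth_on_partials assms)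

text \<open>The equation \<open>\<Omega>' f = 2 \<lambda> f\<close> constrains \<open>f\<close> also on the line \<open>x = 0\<close>, where it reads
  \<open>\<lambda> f = 0\<close>; there it follows from the equation off the line by continuity.\<close>

lemma ker_Omega'_iff:
  fixes lam :: real
  assumes f: "f \<in> noncompact q (- 1 / 2) (\<i> / 2)"
  shows "(\<forall>t x. Omega' q (- 1 / 2) (\<i> / 2) f (t, x) - 2 * of_real lam * f (t, x) = 0) \<longleftrightarrow>
    (\<forall>t x. x \<noteq> 0 \<longrightarrow> Box f (t, x) = 2 * of_real lam / of_real x ^ 2 * f (t, x))"
proof -
  have off: "of_real x ^ 2 * Box f (t, x) = 2 * of_real lam * f (t, x) \<longleftrightarrow>
      Box f (t, x) = 2 * of_real lam / of_real x ^ 2 * f (t, x)" if "x \<noteq> 0" for t x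
    using that by (simp add: field_simps)
  have sm: "smooth_on UNIV f" using f by (simp add: noncompact_def)
  have "of_real x ^ 2 * Box f (t, x) = 2 * of_real lam * f (t, x)"
    if "\<And>y. y \<noteq> 0 \<Longrightarrow> of_real y ^ 2 * Box f (t, y) = 2 * of_real lam * f (t, y)" for t x
  proof (cases "x = 0")
    case True
    have "of_real 0 ^ 2 * Box f (t, 0) = 2 * of_real lam * f (t, 0)"
    proof (rule eq_at_zero_if_eq_off_zero)
      show "continuous_on UNIV (\<lambda>y. of_real y ^ 2 * Box f (t, y))"
        "continuous_on UNIV (\<lambda>y. 2 * of_real lam * f (t, y))"
        by (intro continuous_intros continuous_on_compose2[OF continuous_on_Box[OF sm]]
            continuous_on_compose2[OF smooth_on_UNIV_D(2)[OF sm]]; simp)+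
    qed (rule that)
    with True show ?thesis by simp
  qed (rule that)
  then show ?thesis unfolding Omega'_eq_Box[OF f] using off by (metis eq_iff_diff_eq_0)
qed

theorem corollary2:
  fixes q :: nat and r s :: complex and lam :: real
  assumes "q \<in> {0..3}"
  shows "(\<forall>f\<in>noncompact q r s. \<forall>t x.
        Omega q r s f (t, x) =
          1 / 2 * (4 * s * of_real x ^ 2 * d_t f (t, x) + of_real x ^ 2 * d_x (d_x f) (t, x)
            - (1 + 2 * r) * of_real x * d_x f (t, x) + r * (r + 2) * f (t, x)))
    \<and> (\<forall>f\<in>noncompact q (- 1 / 2) (\<i> / 2). \<forall>t x.
        Omega' q (- 1 / 2) (\<i> / 2) f (t, x) - 2 * of_real lam * f (t, x) =
          of_real x ^ 2 * Box f (t, x) - 2 * of_real lam * f (t, x)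
        \<and> (x \<noteq> 0 \<longrightarrow>
            Omega' q (- 1 / 2) (\<i> / 2) f (t, x) - 2 * of_real lam * f (t, x) =
              of_real x ^ 2 * (Box f (t, x) - 2 * of_real lam / of_real x ^ 2 * f (t, x))))
    \<and> {f \<in> noncompact q (- 1 / 2) (\<i> / 2). \<forall>t x.
          Omega' q (- 1 / 2) (\<i> / 2) f (t, x) - 2 * of_real lam * f (t, x) = 0}
      = {f \<in> noncompact q (- 1 / 2) (\<i> / 2). \<forall>t x. x \<noteq> 0 \<longrightarrow>
          Box f (t, x) = 2 * of_real lam / of_real x ^ 2 * f (t, x)}"
proof (intro conjI ballI allI impI)
  show "{f \<in> noncompact q (- 1 / 2) (\<i> / 2). \<forall>t x.
          Omega' q (- 1 / 2) (\<i> / 2) f (t, x) - 2 * of_real lam * f (t, x) = 0}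
      = {f \<in> noncompact q (- 1 / 2) (\<i> / 2). \<forall>t x. x \<noteq> 0 \<longrightarrow>
          Box f (t, x) = 2 * of_real lam / of_real x ^ 2 * f (t, x)}"
    by (intro Collect_cong conj_cong refl ker_Omega'_iff)
qed (simp_all add: Omega_eq Omega'_eq_Box[simplified] right_diff_distrib del: times_divide_eq_left)

end
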